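(* Let $1\le q\le n$ be integers, let $v\in\mathbb{R}^n$ be a vector all of whose entries are positive, and let $\mathcal{F}_v=\{X\in\mathbb{R}^{n\times q}: X^TX=I_q,\ v\in\mathrm{span}(X)\}$. Then $\mathcal{F}_v$ is an embedded submanifold of the Stiefel manifold $\mathrm{St}(q,n)$ of dimension $\dim(\mathrm{St}(q,n))-(n-q)=nq-q(q+1)/2-n+q$. Furthermore, $\mathcal{F}_v$ is an embedded submanifold of $\mathbb{R}^{n\times q}$ of the same dimension, and $\mathcal{F}_v$ is compact.
   Context: $\mathrm{St}(q,n)=\{X\in\mathbb{R}^{n\times q}:X^TX=I_q\}$ is the (compact) Stiefel manifold, viewed as an embedded submanifold of $\mathbb{R}^{n\times q}$. $\mathrm{span}(X)$ denotes the column space of $X$. *)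

theory Defs
  imports "HOL-Analysis.Analysis"
begin

section \<open>Smooth maps\<close>

text \<open>
  Intended for an open set \<open>U\<close>.  In finite dimension, \<open>f\<close> is $C^{r+1}$ iff it is differentiable
  and all its directional derivatives \<open>\<lambda>x. Df(x) h\<close> are $C^r$.
\<close>

primrec Ck_on :: "nat \<Rightarrow> 'a::euclidean_space set \<Rightarrow> ('a \<Rightarrow> 'b::euclidean_space) \<Rightarrow> bool" where
  "Ck_on 0 U f \<longleftrightarrow> continuous_on U f"
| "Ck_on (Suc r) U f \<longleftrightarrow>
     (\<forall>x\<in>U. f differentiable (at x)) \<and> (\<forall>h. Ck_on r U (\<lambda>x. frechet_derivative f (at x) h))"

text \<open>
  On an arbitrary subset \<open>S\<close> of a Euclidean space, smoothness means the local existence of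
  $C^\infty$ extensions to open sets of the ambient space.  When \<open>S\<close> is an embedded submanifold,
  this is smoothness for its induced smooth structure; when \<open>S\<close> is open, it is ordinary
  $C^\infty$ smoothness.
\<close>

definition smooth_on :: "'a::euclidean_space set \<Rightarrow> ('a \<Rightarrow> 'b::euclidean_space) \<Rightarrow> bool" where
  "smooth_on S f \<longleftrightarrow>
     (\<forall>x\<in>S. \<exists>U g. open U \<and> x \<in> U \<and> (\<forall>r. Ck_on r U g) \<and> (\<forall>y\<in>U \<inter> S. g y = f y))"

section \<open>Embedded submanifolds\<close>

text \<open>
  A smooth chart \<open>\<phi>\<close> of \<open>N\<close> with domain \<open>W\<close>: a diffeomorphism from a relatively open subset of \<open>N\<close>
  onto an open subset of the model space \<open>L\<close>.  Since the dimension of \<open>N\<close> is a number and not a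
  type, the model space is a linear subspace of the ambient space instead of a coordinate space.
\<close>

definition smooth_chart ::
  "'a::euclidean_space set \<Rightarrow> 'a set \<Rightarrow> 'a set \<Rightarrow> ('a \<Rightarrow> 'a) \<Rightarrow> bool" where
  "smooth_chart N L W \<phi> \<longleftrightarrow>
     openin (top_of_set N) W \<and> subspace L \<and> openin (top_of_set L) (\<phi> ` W) \<and>
     inj_on \<phi> W \<and> smooth_on W \<phi> \<and> smooth_on (\<phi> ` W) (inv_into W \<phi>)"

text \<open>
  The local \<open>k\<close>-slice condition for \<open>M\<close> inside the \<open>m\<close>-dimensional manifold \<open>N\<close>: around each point
  of \<open>M\<close> some chart of \<open>N\<close> maps \<open>M\<close> to a \<open>k\<close>-dimensional linear slice of its image.
\<close>

definition slice_condition ::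
  "'a::euclidean_space set \<Rightarrow> nat \<Rightarrow> 'a set \<Rightarrow> nat \<Rightarrow> bool" where
  "slice_condition N m M k \<longleftrightarrow>
     (\<forall>x\<in>M. \<exists>L W \<phi> K. x \<in> W \<and> smooth_chart N L W \<phi> \<and> dim L = m \<and>
        subspace K \<and> K \<subseteq> L \<and> dim K = k \<and> \<phi> ` (W \<inter> M) = \<phi> ` W \<inter> K)"

definition embedded_submanifold :: "'a::euclidean_space set \<Rightarrow> nat \<Rightarrow> bool" where
  "embedded_submanifold M k \<longleftrightarrow> slice_condition UNIV DIM('a) M k"

text \<open>\<open>M\<close> is a \<open>k\<close>-dimensional embedded submanifold of the manifold \<open>N\<close>.\<close>

definition embedded_submanifold_of ::
  "'a::euclidean_space set \<Rightarrow> 'a set \<Rightarrow> nat \<Rightarrow> bool" where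
  "embedded_submanifold_of N M k \<longleftrightarrow>
     M \<subseteq> N \<and> (\<exists>m. embedded_submanifold N m \<and> slice_condition N m M k)"

section \<open>The Stiefel manifold\<close>

text \<open>The type \<open>real^'q^'n\<close> consists of the matrices with \<open>CARD('n)\<close> rows and \<open>CARD('q)\<close> columns.\<close>

definition stiefel :: "(real^'q^'n) set" where
  "stiefel = {X. transpose X ** X = mat 1}"

definition stiefel_through :: "real^'n \<Rightarrow> (real^'q^'n) set" where
  "stiefel_through v = {X. transpose X ** X = mat 1 \<and> v \<in> span (columns X)}"

end

theory Submission
  imports Defs
begin

text \<open>
  Everything is read off one explicit rational chart. Around \<open>P\<close> in the Stiefel manifold write
  \<open>S = (1 + P\<^sup>TX)\<^sup>-\<^sup>1\<close>, \<open>Y = (X + P)S - P\<close> (which has columns orthogonal to \<open>span P\<close>) and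
  \<open>T = 2S - 1 - Y\<^sup>TY\<close>, a Cayley transform. Then \<open>X\<^sup>TX = 1\<close> iff \<open>T\<close> is skew, and for \<open>v = P u\<close> one has
  \<open>v \<in> span X\<close> iff \<open>Y(1 - T)\<^sup>-\<^sup>1 u = 0\<close>. Hence in the coordinate \<open>W = P T + Y(1 - T)\<^sup>-\<^sup>1\<close> on the ambient
  space both manifolds are linear slices, whose dimensions follow from rank-nullity.
\<close>

section \<open>Calculus of $C^r$ maps\<close>

text \<open>At a point of an open set the derivative depends only on the values in that set, so
  agreement on \<open>U\<close> passes to all directional derivatives.\<close>

lemma Ck_on_cong:
  assumes "open U" and "\<And>x. x \<in> U \<Longrightarrow> f x = g x" and "Ck_on r U f"
  shows "Ck_on r U g"
  using assms(2,3)
proof (induction r arbitrary: f g)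
  case 0
  then show ?case using continuous_on_cong by fastforce
next
  case (Suc r)
  have der: "(g has_derivative frechet_derivative f (at x)) (at x)" if "x \<in> U" for x
    using Suc.prems that has_derivative_transform_within_open[OF _ assms(1) that, of f _ UNIV g]
    by (simp add: frechet_derivative_works)
  have "Ck_on r U (\<lambda>x. frechet_derivative g (at x) h)" for h
    by (rule Suc.IH[of "\<lambda>x. frechet_derivative f (at x) h"])
      (use Suc.prems(2) in \<open>simp_all flip: frechet_derivative_at[OF der]\<close>)
  with der show ?case unfolding Ck_on.simps differentiable_def by blast
qed

text \<open>Uniqueness of the derivative lets any explicit formula \<open>f'\<close> stand in for
  \<open>frechet_derivative\<close>; the closure rules below feed in the classical differentiation
  rules this way.\<close>

lemma Ck_on_SucI:
  assumes "open U" and der: "\<And>x. x \<in> U \<Longrightarrow> (f has_derivative f' x) (at x)"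
    and "\<And>h. Ck_on r U (\<lambda>x. f' x h)"
  shows "Ck_on (Suc r) U f"
  unfolding Ck_on.simps
proof (intro conjI ballI allI)
  show "f differentiable at x" if "x \<in> U" for x
    using der[OF that] by (auto simp: differentiable_def)
  show "Ck_on r U (\<lambda>x. frechet_derivative f (at x) h)" for h
    by (rule Ck_on_cong[OF assms(1) _ assms(3)[of h]]) (simp flip: frechet_derivative_at[OF der])
qed

lemma Ck_on_SucD:
  assumes "Ck_on (Suc r) U f"
  shows "x \<in> U \<Longrightarrow> (f has_derivative frechet_derivative f (at x)) (at x)"
    and "Ck_on r U (\<lambda>x. frechet_derivative f (at x) h)"
  using assms by (auto simp: frechet_derivative_works)

text \<open>The product and reciprocal rules leave undifferentiated factors, and these must be
  lowered by one order for the inductions below.\<close>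

lemma Ck_on_Suc_imp_Ck_on: "Ck_on (Suc r) U f \<Longrightarrow> Ck_on r U f"
proof (induction r arbitrary: f)
  case 0
  then show ?case
    by (auto intro!: continuous_at_imp_continuous_on differentiable_imp_continuous_within)
next
  case (Suc r)
  then show ?case by (metis Ck_on.simps(2))
qed

lemma Ck_on_const: "open U \<Longrightarrow> Ck_on r U (\<lambda>x. c)"
  by (induction r arbitrary: c) (auto simp: frechet_derivative_const)

lemma Ck_on_ident: "open U \<Longrightarrow> Ck_on r U (\<lambda>x. x)"
  by (cases r) (auto simp: Ck_on_const)

lemma Ck_on_bounded_linear:
  assumes "open U" "bounded_linear L" "Ck_on r U f"
  shows "Ck_on r U (\<lambda>x. L (f x))"
  using assms(3)
proof (induction r arbitrary: f)
  case 0
  then show ?case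
    using assms(2) by (simp add: bounded_linear.continuous_on)
next
  case (Suc r)
  show ?case
    by (rule Ck_on_SucI[OF assms(1) bounded_linear.has_derivative[OF assms(2) Ck_on_SucD(1)[OF Suc.prems]]])
      (auto intro: Suc.IH Ck_on_SucD(2)[OF Suc.prems])
qed

lemma Ck_on_add:
  assumes "open U" "Ck_on r U f" "Ck_on r U g"
  shows "Ck_on r U (\<lambda>x. f x + g x)"
  using assms(2,3)
proof (induction r arbitrary: f g)
  case 0
  then show ?case by (simp add: continuous_on_add)
next
  case (Suc r)
  show ?case
    by (rule Ck_on_SucI[OF assms(1) has_derivative_add[OF Ck_on_SucD(1)[OF Suc.prems(1)] Ck_on_SucD(1)[OF Suc.prems(2)]]])
      (auto intro: Suc.IH Ck_on_SucD(2)[OF Suc.prems(1)] Ck_on_SucD(2)[OF Suc.prems(2)])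
qed

text \<open>By the Leibniz rule each directional derivative is a sum of two terms
  \<open>p _ _\<close> whose arguments are one order less smooth, so the induction generalizes over
  both \<open>f\<close> and \<open>g\<close>.\<close>

lemma Ck_on_bounded_bilinear:
  assumes "open U" "bounded_bilinear p" "Ck_on r U f" "Ck_on r U g"
  shows "Ck_on r U (\<lambda>x. p (f x) (g x))"
  using assms(3,4)
proof (induction r arbitrary: f g)
  case 0
  then show ?case
    using assms(2) by (simp add: bounded_bilinear.continuous_on)
next
  case (Suc r)
  show ?case
    by (rule Ck_on_SucI[OF assms(1) bounded_bilinear.FDERIV[OF assms(2) Ck_on_SucD(1)[OF Suc.prems(1)] Ck_on_SucD(1)[OF Suc.prems(2)]]])
      (auto intro!: Ck_on_add assms(1) Suc.IH Ck_on_SucD(2)[OF Suc.prems(1)] Ck_on_SucD(2)[OF Suc.prems(2)]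
        Ck_on_Suc_imp_Ck_on[OF Suc.prems(1)] Ck_on_Suc_imp_Ck_on[OF Suc.prems(2)])
qed

lemma Ck_on_uminus: "open U \<Longrightarrow> Ck_on r U f \<Longrightarrow> Ck_on r U (\<lambda>x. - f x)"
  by (rule Ck_on_bounded_linear[OF _ bounded_linear_minus[OF bounded_linear_ident]])

lemma Ck_on_diff: "open U \<Longrightarrow> Ck_on r U f \<Longrightarrow> Ck_on r U g \<Longrightarrow> Ck_on r U (\<lambda>x. f x - g x)"
  using Ck_on_add[OF _ _ Ck_on_uminus, of U r f g] by simp

lemma Ck_on_mult:
  fixes f g :: "'a::euclidean_space \<Rightarrow> real"
  shows "open U \<Longrightarrow> Ck_on r U f \<Longrightarrow> Ck_on r U g \<Longrightarrow> Ck_on r U (\<lambda>x. f x * g x)"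
  by (rule Ck_on_bounded_bilinear[OF _ bounded_bilinear_mult])

lemma Ck_on_scaleR: "open U \<Longrightarrow> Ck_on r U f \<Longrightarrow> Ck_on r U (\<lambda>x. c *\<^sub>R f x)"
  by (rule Ck_on_bounded_linear[OF _ bounded_linear_scaleR_right])

lemma Ck_on_sum: "open U \<Longrightarrow> (\<And>i. i \<in> I \<Longrightarrow> Ck_on r U (f i)) \<Longrightarrow> Ck_on r U (\<lambda>x. \<Sum>i\<in>I. f i x)"
  by (induction I rule: infinite_finite_induct) (auto intro: Ck_on_const Ck_on_add)

lemma Ck_on_prod:
  fixes f :: "'i \<Rightarrow> 'a::euclidean_space \<Rightarrow> real"
  shows "open U \<Longrightarrow> (\<And>i. i \<in> I \<Longrightarrow> Ck_on r U (f i)) \<Longrightarrow> Ck_on r U (\<lambda>x. \<Prod>i\<in>I. f i x)"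
  by (induction I rule: infinite_finite_induct) (auto intro: Ck_on_const Ck_on_mult)

text \<open>The derivative of \<open>1/f\<close> is again built from \<open>1/f\<close> and the
  derivative of \<open>f\<close>, so the induction hypothesis for the same \<open>f\<close>
  suffices.\<close>

lemma Ck_on_inverse:
  fixes f :: "'a::euclidean_space \<Rightarrow> real"
  assumes "open U" "Ck_on r U f" and nz: "\<And>x. x \<in> U \<Longrightarrow> f x \<noteq> 0"
  shows "Ck_on r U (\<lambda>x. inverse (f x))"
  using assms(2) nz
proof (induction r)
  case 0
  then show ?case by (simp add: continuous_on_inverse)
next
  case (Suc r)
  note inv = Suc.IH[OF Ck_on_Suc_imp_Ck_on[OF Suc.prems(1)] Suc.prems(2)]
  show ?case
    by (rule Ck_on_SucI[OF assms(1) Deriv.has_derivative_inverse[OF Suc.prems(2) Ck_on_SucD(1)[OF Suc.prems(1)]]])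
      (auto intro!: Ck_on_uminus Ck_on_mult assms(1) inv Ck_on_SucD(2)[OF Suc.prems(1)])
qed

lemma Ck_on_vec_nth: "open U \<Longrightarrow> Ck_on r U f \<Longrightarrow> Ck_on r U (\<lambda>x. f x $ i)"
  by (rule Ck_on_bounded_linear[OF _ bounded_linear_vec_nth])

lemma Ck_on_vec_lambda:
  fixes f :: "'a::euclidean_space \<Rightarrow> 'n::finite \<Rightarrow> 'b::euclidean_space"
  assumes "open U" "\<And>i. Ck_on r U (\<lambda>x. f x i)"
  shows "Ck_on r U (\<lambda>x. \<chi> i. f x i)"
proof -
  have lin: "bounded_linear (axis i :: 'b \<Rightarrow> 'b^'n)" for i
    by (intro linear_conv_bounded_linear[THEN iffD1] linearI) (auto simp: axis_def vec_eq_iff)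
  have "(\<chi> i. f x i) = (\<Sum>i\<in>UNIV. axis i (f x i))" for x
    by (simp add: vec_eq_iff axis_def)
  then show ?thesis
    by (auto intro!: Ck_on_sum assms Ck_on_bounded_linear[OF assms(1) lin])
qed

lemma Ck_on_det:
  fixes F :: "'a::euclidean_space \<Rightarrow> real^'n^'n"
  assumes "open U" "\<And>i j. Ck_on r U (\<lambda>x. F x $ i $ j)"
  shows "Ck_on r U (\<lambda>x. det (F x))"
  unfolding det_def by (intro Ck_on_sum Ck_on_mult Ck_on_prod Ck_on_const assms)

section \<open>Matrix inverses and their smooth dependence on the matrix\<close>

lemma matrix_inv:
  fixes A :: "real^'n^'n"
  assumes "invertible A"
  shows matrix_inv_right: "A ** matrix_inv A = mat 1"
    and matrix_inv_left: "matrix_inv A ** A = mat 1"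
  using assms unfolding invertible_def matrix_inv_def by (metis (mono_tags, lifting) someI_ex)+

lemma matrix_inv_eqI:
  fixes A :: "real^'n^'n"
  assumes "A ** B = mat 1"
  shows "matrix_inv A = B"
proof -
  have "invertible A" using assms invertible_right_inverse by blast
  then have "matrix_inv A ** A ** B = B" by (simp add: matrix_inv_left)
  then show ?thesis by (simp add: assms flip: matrix_mul_assoc)
qed

text \<open>Column \<open>j\<close> of the inverse solves \<open>A *v x = axis j 1\<close>, so
  Cramer's rule gives its entries. They are rational in the entries of \<open>A\<close> with
  denominator \<open>det A\<close>, which makes inversion smooth.\<close>

lemma matrix_inv_cramer:
  fixes A :: "real^'n^'n"
  assumes "invertible A"
  shows "matrix_inv A = (\<chi> i j. det (\<chi> k l. if l = i then axis j 1 $ k else A $ k $ l) * inverse (det A))"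
proof -
  have "det A \<noteq> 0" using assms by (simp add: invertible_det_nz)
  then have "matrix_inv A *v axis j 1 = (\<chi> i. det (\<chi> k l. if l = i then axis j 1 $ k else A $ k $ l) / det A)" for j
    by (simp add: matrix_vector_mul_assoc matrix_inv_right[OF assms] flip: cramer)
  then have "column j (matrix_inv A) = (\<chi> i. det (\<chi> k l. if l = i then axis j 1 $ k else A $ k $ l) / det A)" for j
    by (simp add: matrix_vector_mult_basis)
  then show ?thesis
    by (simp add: vec_eq_iff column_def divide_inverse)
qed

lemma Ck_on_matrix_inv:
  fixes F :: "'a::euclidean_space \<Rightarrow> real^'n^'n"
  assumes "open U" "Ck_on r U F" and inv: "\<And>x. x \<in> U \<Longrightarrow> invertible (F x)"
  shows "Ck_on r U (\<lambda>x. matrix_inv (F x))"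
proof (rule Ck_on_cong[OF assms(1)])
  show "(\<chi> i j. det (\<chi> k l. if l = i then axis j 1 $ k else F x $ k $ l) * inverse (det (F x))) = matrix_inv (F x)"
    if "x \<in> U" for x using matrix_inv_cramer[OF inv[OF that]] by simp
  have comp: "Ck_on r U (\<lambda>x. F x $ i $ j)" for i j
    by (intro Ck_on_vec_nth assms)
  \<comment> \<open>The case distinction in Cramer's matrix concerns only the indices, so each entry
    is either a constant or an entry of \<open>F\<close>.\<close>
  have "Ck_on r U (\<lambda>x. if b then c else F x $ i $ j)" for b and c :: real and i j
    using comp Ck_on_const[OF assms(1)] by (cases b) auto
  then show "Ck_on r U (\<lambda>x. \<chi> i j. det (\<chi> k l. if l = i then axis j 1 $ k else F x $ k $ l) * inverse (det (F x)))"
    using inv by (intro Ck_on_vec_lambda Ck_on_mult Ck_on_det Ck_on_inverse assms(1))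
      (auto simp: invertible_det_nz comp)
qed

lemma bounded_bilinear_matrix_mult: "bounded_bilinear ((**) :: real^'m^'n \<Rightarrow> real^'p^'m \<Rightarrow> real^'p^'n)"
  unfolding bilinear_conv_bounded_bilinear [symmetric] bilinear_def
  by (auto intro!: linearI simp: matrix_matrix_mult_def vec_eq_iff sum.distrib sum_distrib_left algebra_simps)

lemma Ck_on_matrix_mult:
  fixes f :: "'a::euclidean_space \<Rightarrow> real^'m^'n" and g :: "'a \<Rightarrow> real^'p^'m"
  shows "open U \<Longrightarrow> Ck_on r U f \<Longrightarrow> Ck_on r U g \<Longrightarrow> Ck_on r U (\<lambda>x. f x ** g x)"
  by (rule Ck_on_bounded_bilinear[OF _ bounded_bilinear_matrix_mult])

lemma bounded_linear_transpose: "bounded_linear (transpose :: real^'m^'n \<Rightarrow> real^'n^'m)"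
  by (intro linear_conv_bounded_linear[THEN iffD1] linearI) (auto simp: transpose_def vec_eq_iff)

lemma Ck_on_transpose:
  fixes f :: "'a::euclidean_space \<Rightarrow> real^'m^'n"
  shows "open U \<Longrightarrow> Ck_on r U f \<Longrightarrow> Ck_on r U (\<lambda>x. transpose (f x))"
  by (rule Ck_on_bounded_linear[OF _ bounded_linear_transpose])

lemmas Ck_on_intros = Ck_on_const Ck_on_ident Ck_on_add Ck_on_diff Ck_on_scaleR Ck_on_matrix_mult
  Ck_on_transpose Ck_on_matrix_inv

text \<open>Invertibility is the open condition \<open>det \<noteq> 0\<close>. The set
  \<open>U\<close> is kept general because \<open>F\<close> may itself contain inverses and be
  continuous only on \<open>U\<close>.\<close>

lemma open_invertible:
  fixes F :: "'a::euclidean_space \<Rightarrow> real^'n^'n"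
  assumes "open U" "Ck_on 0 U F"
  shows "open {x \<in> U. invertible (F x)}"
proof -
  have "continuous_on U (\<lambda>x. det (F x))"
    using Ck_on_det[OF assms(1), of 0 F] Ck_on_vec_nth[OF assms(1) Ck_on_vec_nth[OF assms]] by simp
  then have "open (U \<inter> (\<lambda>x. det (F x)) -` (- {0}))"
    using assms(1) by (intro continuous_open_preimage) auto
  then show ?thesis
    by (simp add: vimage_def Int_def invertible_det_nz)
qed

section \<open>Slice charts from ambient diffeomorphisms\<close>

lemma image_Int_eq_of_inverse:
  assumes UV: "\<And>x. x \<in> U \<Longrightarrow> \<Phi> x \<in> V \<and> \<Psi> (\<Phi> x) = x"
    and VU: "\<And>y. y \<in> V \<Longrightarrow> \<Psi> y \<in> U \<and> \<Phi> (\<Psi> y) = y"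
    and NL: "\<And>y. y \<in> V \<Longrightarrow> \<Psi> y \<in> N \<longleftrightarrow> y \<in> L"
  shows "\<Phi> ` (U \<inter> N) = V \<inter> L"
proof (intro equalityI subsetI)
  fix y assume "y \<in> \<Phi> ` (U \<inter> N)"
  then obtain x where "x \<in> U" "x \<in> N" "y = \<Phi> x" by blast
  then show "y \<in> V \<inter> L" using UV[of x] NL[of y] by simp
next
  fix y assume "y \<in> V \<inter> L"
  then have "\<Psi> y \<in> U \<inter> N" "y = \<Phi> (\<Psi> y)" using VU[of y] NL[of y] by auto
  then show "y \<in> \<Phi> ` (U \<inter> N)" by blast
qed

text \<open>An ambient diffeomorphism that carries \<open>N\<close> to \<open>L\<close> restricts to
  a chart of \<open>N\<close>: \<open>\<Phi>\<close> and \<open>\<Psi>\<close> themselves are the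
  smooth extensions that \<open>smooth_on\<close> asks for.\<close>

lemma smooth_chart_restrict:
  assumes "open U" "open V" "\<And>r. Ck_on r U \<Phi>" "\<And>r. Ck_on r V \<Psi>"
    and UV: "\<And>x. x \<in> U \<Longrightarrow> \<Phi> x \<in> V \<and> \<Psi> (\<Phi> x) = x"
    and VU: "\<And>y. y \<in> V \<Longrightarrow> \<Psi> y \<in> U \<and> \<Phi> (\<Psi> y) = y"
    and "subspace L"
    and NL: "\<And>y. y \<in> V \<Longrightarrow> \<Psi> y \<in> N \<longleftrightarrow> y \<in> L"
  shows "smooth_chart N L (U \<inter> N) \<Phi>"
  unfolding smooth_chart_def
proof (intro conjI)
  have im: "\<Phi> ` (U \<inter> N) = V \<inter> L"
    using UV VU NL by (rule image_Int_eq_of_inverse)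
  show inj: "inj_on \<Phi> (U \<inter> N)"
    using UV by (metis IntD1 inj_onI)
  show "openin (top_of_set N) (U \<inter> N)"
    using openin_open_Int[OF assms(1)] by (simp add: Int_commute)
  show "openin (top_of_set L) (\<Phi> ` (U \<inter> N))"
    using openin_open_Int[OF assms(2)] im by (simp add: Int_commute)
  show "smooth_on (U \<inter> N) \<Phi>"
    unfolding smooth_on_def using assms(1,3) by blast
  have "\<Psi> y = inv_into (U \<inter> N) \<Phi> y" if "y \<in> V \<inter> L" for y
    using that VU[of y] NL[of y] by (intro inv_into_f_eq[OF inj, symmetric]) auto
  then show "smooth_on (\<Phi> ` (U \<inter> N)) (inv_into (U \<inter> N) \<Phi>)"
    unfolding smooth_on_def im using assms(2,4) by blast
qed fact

text \<open>A single ambient diffeomorphism flattens \<open>N\<close> and \<open>M\<close> at once.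
  Both memberships are tested on the coordinate side, where they are linear conditions.\<close>

lemma slice_conditionI:
  fixes M N :: "'a::euclidean_space set"
  assumes charts: "\<And>x. x \<in> M \<Longrightarrow> \<exists>U V (\<Phi> :: 'a \<Rightarrow> 'a) \<Psi> L K. x \<in> U \<and> open U \<and> open V \<and>
      (\<forall>r. Ck_on r U \<Phi>) \<and> (\<forall>r. Ck_on r V \<Psi>) \<and>
      (\<forall>x\<in>U. \<Phi> x \<in> V \<and> \<Psi> (\<Phi> x) = x) \<and> (\<forall>y\<in>V. \<Psi> y \<in> U \<and> \<Phi> (\<Psi> y) = y) \<and>
      subspace L \<and> subspace K \<and> K \<subseteq> L \<and> dim L = m \<and> dim K = k \<and>
      (\<forall>y\<in>V. \<Psi> y \<in> N \<longleftrightarrow> y \<in> L) \<and> (\<forall>y\<in>V. \<Psi> y \<in> M \<longleftrightarrow> y \<in> K)"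
    and "M \<subseteq> N"
  shows "slice_condition N m M k"
  unfolding slice_condition_def
proof
  fix x assume "x \<in> M"
  from charts[OF this] obtain U V L K :: "'a set" and \<Phi> \<Psi> :: "'a \<Rightarrow> 'a"
    where *: "x \<in> U" "open U" "open V" "\<forall>r. Ck_on r U \<Phi>" "\<forall>r. Ck_on r V \<Psi>"
    and UV: "\<forall>x\<in>U. \<Phi> x \<in> V \<and> \<Psi> (\<Phi> x) = x" and VU: "\<forall>y\<in>V. \<Psi> y \<in> U \<and> \<Phi> (\<Psi> y) = y"
    and **: "subspace L" "subspace K" "K \<subseteq> L" "dim L = m" "dim K = k"
    and NL: "\<forall>y\<in>V. \<Psi> y \<in> N \<longleftrightarrow> y \<in> L" and MK: "\<forall>y\<in>V. \<Psi> y \<in> M \<longleftrightarrow> y \<in> K"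
    by (elim exE conjE)
  have "smooth_chart N L (U \<inter> N) \<Phi>"
    using * ** UV VU NL by (intro smooth_chart_restrict[of U V \<Phi> \<Psi>]) auto
  moreover have "\<Phi> ` (U \<inter> M) = V \<inter> K" "\<Phi> ` (U \<inter> N) = V \<inter> L"
    using image_Int_eq_of_inverse[of U \<Phi> V \<Psi>] UV VU NL MK by auto
  moreover have "U \<inter> N \<inter> M = U \<inter> M"
    using \<open>M \<subseteq> N\<close> by blast
  ultimately show "\<exists>L W \<phi> K. x \<in> W \<and> smooth_chart N L W \<phi> \<and> dim L = m \<and> subspace K \<and> K \<subseteq> L \<and> dim K = k \<and>
      \<phi> ` (W \<inter> M) = \<phi> ` W \<inter> K"
    using * ** \<open>x \<in> M\<close> \<open>M \<subseteq> N\<close>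
    by (intro exI[of _ L] exI[of _ "U \<inter> N"] exI[of _ \<Phi>] exI[of _ K]) auto
qed

section \<open>The Cayley chart of the Stiefel manifold\<close>

lemmas matrix_distribs = bounded_bilinear.add_left[OF bounded_bilinear_matrix_mult]
  bounded_bilinear.add_right[OF bounded_bilinear_matrix_mult]
  bounded_bilinear.diff_left[OF bounded_bilinear_matrix_mult]
  bounded_bilinear.diff_right[OF bounded_bilinear_matrix_mult]
  bounded_bilinear.scaleR_left[OF bounded_bilinear_matrix_mult]
  bounded_bilinear.scaleR_right[OF bounded_bilinear_matrix_mult]
  bounded_bilinear.zero_left[OF bounded_bilinear_matrix_mult]
  bounded_bilinear.zero_right[OF bounded_bilinear_matrix_mult]
  linear_add[OF bounded_linear.linear[OF bounded_linear_transpose]]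
  linear_diff[OF bounded_linear.linear[OF bounded_linear_transpose]]
  linear_scale[OF bounded_linear.linear[OF bounded_linear_transpose]]
  linear_0[OF bounded_linear.linear[OF bounded_linear_transpose]]
  matrix_transpose_mul

lemma matrix_mult_left_cancel:
  fixes A :: "real^'n^'n"
  assumes "invertible A"
  shows "A ** B = A ** C \<longleftrightarrow> B = C"
  by (metis assms matrix_inv_left matrix_mul_assoc matrix_mul_lid)

lemma matrix_mult_right_cancel:
  fixes A :: "real^'n^'n"
  assumes "invertible A"
  shows "B ** A = C ** A \<longleftrightarrow> B = C"
  by (metis assms matrix_inv_right matrix_mul_assoc matrix_mul_rid)

text \<open>Recovers \<open>Y\<close> from the coordinate \<open>W = P T + Y(1 - T)^-1\<close>: here
  \<open>T\<close> is \<open>P^T W\<close>, subtracting \<open>P T\<close> isolates the second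
  summand, and the right factor removes the inverse.\<close>

definition stiefel_normal :: "real^'q^'n \<Rightarrow> real^'q^'n \<Rightarrow> real^'q^'n" where
  "stiefel_normal P W = (W - P ** (transpose P ** W)) ** (mat 1 - transpose P ** W)"

text \<open>Solving \<open>T = 2S - 1 - Y^T Y\<close> for \<open>S\<close> gives
  \<open>2S = 1 + T + Y^T Y\<close>, which is this matrix.\<close>

definition stiefel_denom :: "real^'q^'n \<Rightarrow> real^'q^'n \<Rightarrow> real^'q^'q" where
  "stiefel_denom P W = mat 1 + transpose P ** W + transpose (stiefel_normal P W) ** stiefel_normal P W"

text \<open>The solution \<open>X\<close> of \<open>Y = (X + P)S - P\<close> with \<open>S\<close>
  equal to half of \<open>stiefel_denom P W\<close>.\<close>

definition stiefel_param :: "real^'q^'n \<Rightarrow> real^'q^'n \<Rightarrow> real^'q^'n" where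
  "stiefel_param P W = 2 *\<^sub>R ((P + stiefel_normal P W) ** matrix_inv (stiefel_denom P W)) - P"

definition stiefel_param_dom :: "real^'q^'n \<Rightarrow> (real^'q^'n) set" where
  "stiefel_param_dom P = {W. invertible (stiefel_denom P W) \<and> invertible (mat 1 - transpose P ** W)}"

definition chart_normal :: "real^'q^'n \<Rightarrow> real^'q^'n \<Rightarrow> real^'q^'n" where
  "chart_normal P X = (X + P) ** matrix_inv (mat 1 + transpose P ** X) - P"

definition chart_tangent :: "real^'q^'n \<Rightarrow> real^'q^'n \<Rightarrow> real^'q^'q" where
  "chart_tangent P X = 2 *\<^sub>R matrix_inv (mat 1 + transpose P ** X) - mat 1
     - transpose (chart_normal P X) ** chart_normal P X"

definition stiefel_chart :: "real^'q^'n \<Rightarrow> real^'q^'n \<Rightarrow> real^'q^'n" where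
  "stiefel_chart P X = P ** chart_tangent P X + chart_normal P X ** matrix_inv (mat 1 - chart_tangent P X)"

definition stiefel_chart_dom :: "real^'q^'n \<Rightarrow> (real^'q^'n) set" where
  "stiefel_chart_dom P = {X. invertible (mat 1 + transpose P ** X) \<and> invertible (mat 1 - chart_tangent P X)}"

section \<open>The two coordinate maps are mutually inverse\<close>

lemma invertible_scaleR:
  fixes A :: "real^'n^'n"
  assumes "c \<noteq> 0" "A ** B = mat 1"
  shows "invertible (c *\<^sub>R A)" "matrix_inv (c *\<^sub>R A) = inverse c *\<^sub>R B"
proof -
  have *: "(c *\<^sub>R A) ** (inverse c *\<^sub>R B) = mat 1"
    using assms by (simp add: matrix_distribs)
  show "matrix_inv (c *\<^sub>R A) = inverse c *\<^sub>R B"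
    using * by (rule matrix_inv_eqI)
  show "invertible (c *\<^sub>R A)"
    using * invertible_right_inverse by blast
qed

context
  fixes P :: "real^'q^'n"
  assumes P: "transpose P ** P = mat 1"
begin

lemma transpose_mult_absorb: "transpose P ** (P ** A) = A"
  by (simp add: P matrix_mul_assoc)

lemma transpose_mult_stiefel_normal: "transpose P ** stiefel_normal P W = 0"
  by (simp add: stiefel_normal_def matrix_mul_assoc matrix_distribs P)

text \<open>Since \<open>P^T Y = 0\<close>, one gets \<open>1 + P^T X = 2 D^-1\<close>, so the
  matrix \<open>S\<close> of the chart is \<open>D/2\<close>. Then \<open>chart_normal\<close>
  returns \<open>Y\<close> and \<open>chart_tangent\<close> returns \<open>P^T W\<close>, from which
  \<open>W\<close> is reassembled.\<close>

lemma stiefel_param_inverse: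
  assumes "W \<in> stiefel_param_dom P"
  shows "stiefel_param P W \<in> stiefel_chart_dom P" "stiefel_chart P (stiefel_param P W) = W"
proof -
  define Y where "Y = stiefel_normal P W"
  define D where "D = stiefel_denom P W"
  define X where "X = stiefel_param P W"
  have invD: "invertible D" and invM: "invertible (mat 1 - transpose P ** W)"
    using assms by (auto simp: stiefel_param_dom_def D_def)
  have PY: "transpose P ** Y = 0"
    by (simp add: Y_def transpose_mult_stiefel_normal)
  have X: "X = 2 *\<^sub>R ((P + Y) ** matrix_inv D) - P"
    by (simp add: X_def stiefel_param_def D_def Y_def)
  have PX: "mat 1 + transpose P ** X = 2 *\<^sub>R matrix_inv D"
    by (simp add: X matrix_distribs matrix_mul_assoc P PY)
  note S = invertible_scaleR[of 2, OF _ matrix_inv_left[OF invD], simplified, folded PX]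
  have Y: "chart_normal P X = Y"
    by (simp add: chart_normal_def S(2))
      (simp add: X matrix_distribs matrix_inv_left[OF invD] flip: matrix_mul_assoc)
  have T: "chart_tangent P X = transpose P ** W"
    by (simp add: chart_tangent_def S(2) Y) (simp add: D_def Y_def stiefel_denom_def)
  show "stiefel_param P W \<in> stiefel_chart_dom P"
    using S(1) invM by (simp add: stiefel_chart_dom_def T flip: X_def)
  have "Y ** matrix_inv (mat 1 - transpose P ** W) = W - P ** (transpose P ** W)"
    unfolding Y_def stiefel_normal_def by (simp add: matrix_inv_right[OF invM] flip: matrix_mul_assoc)
  then show "stiefel_chart P (stiefel_param P W) = W"
    by (simp add: stiefel_chart_def T Y flip: X_def)
qed

text \<open>Again \<open>P^T Y = 0\<close>, hence \<open>P^T W = T\<close>; this yields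
  \<open>stiefel_normal P W = Y\<close> and \<open>stiefel_denom P W = 2 A^-1\<close>, and solving
  for \<open>X\<close> undoes the definition of \<open>Y\<close>.\<close>

lemma stiefel_chart_inverse:
  assumes "X \<in> stiefel_chart_dom P"
  shows "stiefel_chart P X \<in> stiefel_param_dom P" "stiefel_param P (stiefel_chart P X) = X"
proof -
  define A where "A = mat 1 + transpose P ** X"
  define Y where "Y = chart_normal P X"
  define T where "T = chart_tangent P X"
  define W where "W = stiefel_chart P X"
  have invA: "invertible A" and invT: "invertible (mat 1 - T)"
    using assms by (auto simp: stiefel_chart_dom_def A_def T_def)
  have Y: "Y = (X + P) ** matrix_inv A - P"
    by (simp add: Y_def A_def chart_normal_def)
  have "transpose P ** Y = A ** matrix_inv A - mat 1"
    by (simp add: Y A_def matrix_distribs matrix_mul_assoc P)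
  then have PY: "transpose P ** Y = 0"
    by (simp add: matrix_inv_right[OF invA])
  have W: "W = P ** T + Y ** matrix_inv (mat 1 - T)"
    by (simp add: W_def stiefel_chart_def T_def Y_def)
  have PW: "transpose P ** W = T"
    by (simp add: W matrix_distribs matrix_mul_assoc P PY)
  have N: "stiefel_normal P W = Y"
    unfolding stiefel_normal_def PW
    by (simp add: W matrix_inv_left[OF invT] flip: matrix_mul_assoc)
  have D: "stiefel_denom P W = 2 *\<^sub>R matrix_inv A"
    unfolding stiefel_denom_def N PW by (simp add: T_def chart_tangent_def flip: Y_def A_def)
  note S = invertible_scaleR[of 2, OF _ matrix_inv_left[OF invA], simplified, folded D]
  show "stiefel_chart P X \<in> stiefel_param_dom P"
    using S(1) invT by (simp add: stiefel_param_dom_def PW flip: W_def)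
  have "stiefel_param P W = (P + Y) ** A - P"
    by (simp add: stiefel_param_def N S(2) matrix_distribs)
  also have "\<dots> = X"
    by (simp add: Y matrix_inv_left[OF invA] flip: matrix_mul_assoc)
  finally show "stiefel_param P (stiefel_chart P X) = X"
    by (simp add: W_def)
qed

text \<open>At \<open>X = P\<close> one has \<open>S = 1/2\<close>, \<open>Y = 0\<close> and
  \<open>T = 0\<close>, so the two matrices to be inverted are \<open>2\<close> and
  \<open>1\<close>.\<close>

lemma base_in_stiefel_chart_dom: "P \<in> stiefel_chart_dom P"
proof -
  have two: "mat 1 + transpose P ** P = 2 *\<^sub>R (mat 1 :: real^'q^'q)"
    by (simp add: P scaleR_2)
  have "invertible (2 *\<^sub>R (mat 1 :: real^'q^'q))" and inv: "matrix_inv (2 *\<^sub>R (mat 1 :: real^'q^'q)) = (1/2) *\<^sub>R mat 1"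
    using invertible_scaleR[of 2 "mat 1 :: real^'q^'q" "mat 1"] by (simp_all add: inverse_eq_divide)
  moreover have "chart_normal P P = 0"
    unfolding chart_normal_def two inv by (simp add: matrix_distribs)
  then have "chart_tangent P P = 0"
    unfolding chart_tangent_def two inv by simp
  ultimately show ?thesis
    by (auto simp: stiefel_chart_dom_def two invertible_def)
qed

text \<open>With \<open>Y = stiefel_normal P W\<close>, \<open>R\<close> the inverse of \<open>D = 1 + P\<^sup>TW + Y\<^sup>TY\<close> and
  \<open>X = 2(P + Y)R - P\<close>, one has \<open>D\<^sup>T(X\<^sup>TX - 1)D = 4(1 + Y\<^sup>TY) - 2D - 2D\<^sup>T = -2(P\<^sup>TW + W\<^sup>TP)\<close>.\<close>
lemma stiefel_param_in_stiefel_iff: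
  assumes "W \<in> stiefel_param_dom P"
  shows "stiefel_param P W \<in> stiefel \<longleftrightarrow> transpose P ** W + transpose W ** P = 0"
proof -
  define Y where "Y = stiefel_normal P W"
  define D where "D = stiefel_denom P W"
  define X where "X = stiefel_param P W"
  have invD: "invertible D"
    using assms by (auto simp: stiefel_param_dom_def D_def)
  then have invDT: "invertible (transpose D)"
    by (simp add: transpose_invertible)
  have PY: "transpose P ** Y = 0"
    by (simp add: Y_def transpose_mult_stiefel_normal)
  have "transpose Y ** P = transpose (transpose P ** Y)"
    by (simp add: matrix_transpose_mul)
  then have YP: "transpose Y ** P = 0"
    by (simp add: PY matrix_distribs)
  have XD: "X ** D = 2 *\<^sub>R (P + Y) - P ** D"
    by (simp add: X_def stiefel_param_def matrix_distribs matrix_inv_left[OF invD] flip: matrix_mul_assoc D_def Y_def)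
  have D: "D = mat 1 + transpose P ** W + transpose Y ** Y"
    by (simp add: D_def stiefel_denom_def Y_def)
  have "transpose D ** (transpose X ** X) ** D = transpose (X ** D) ** (X ** D)"
    by (simp add: matrix_transpose_mul matrix_mul_assoc)
  also have "\<dots> = 4 *\<^sub>R (mat 1 + transpose Y ** Y) - 2 *\<^sub>R D - 2 *\<^sub>R transpose D + transpose D ** D"
    unfolding XD
    by (simp add: matrix_distribs PY YP P transpose_mult_absorb matrix_mul_assoc algebra_simps)
      (simp add: matrix_distribs PY YP P transpose_mult_absorb algebra_simps flip: matrix_mul_assoc)
  also have "\<dots> = transpose D ** D - 2 *\<^sub>R (transpose P ** W + transpose W ** P)"
  proof -
    \<comment> \<open>The sum of \<open>D\<close> and its transpose is \<open>2(1 + Y^T Y)\<close>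
      plus the symmetric expression in \<open>P\<close> and \<open>W\<close>, so the quadratic terms
      in \<open>Y\<close> cancel.\<close>
    have "4 *\<^sub>R (mat 1 + transpose Y ** Y) - 2 *\<^sub>R D - 2 *\<^sub>R transpose D =
        - (2 *\<^sub>R (transpose P ** W + transpose W ** P))"
      by (simp add: D matrix_distribs) (simp add: vec_eq_iff)
    then show ?thesis by simp
  qed
  finally have *: "transpose D ** (transpose X ** X) ** D = transpose D ** D - 2 *\<^sub>R (transpose P ** W + transpose W ** P)" .
  \<comment> \<open>Congruence by the invertible \<open>D\<close> turns \<open>X^T X = 1\<close>
    into an equivalent equation free of \<open>matrix_inv D\<close>.\<close>
  have "X \<in> stiefel \<longleftrightarrow> transpose D ** (transpose X ** X) ** D = transpose D ** mat 1 ** D"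
    unfolding matrix_mult_right_cancel[OF invD] matrix_mult_left_cancel[OF invDT] by (simp add: stiefel_def)
  also have "\<dots> \<longleftrightarrow> transpose P ** W + transpose W ** P = 0"
    unfolding * by simp
  finally show ?thesis
    by (simp add: X_def)
qed

text \<open>If \<open>X u = P u0\<close> for \<open>X = stiefel_param P W\<close>, then \<open>w = u + u0\<close> satisfies \<open>Y w = 0\<close> and
  \<open>(1 - P\<^sup>TW) w = 2 u0\<close>; the factor \<open>1 - P\<^sup>TW\<close> in \<^const>\<open>stiefel_normal\<close> is there to make the
  resulting condition linear in \<open>W\<close>.\<close>
lemma range_stiefel_param_iff:
  assumes "W \<in> stiefel_param_dom P"
  shows "P *v u0 \<in> range ((*v) (stiefel_param P W)) \<longleftrightarrow> (W - P ** (transpose P ** W)) *v u0 = 0"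
proof -
  define T where "T = transpose P ** W"
  define Y where "Y = stiefel_normal P W"
  define D where "D = stiefel_denom P W"
  define X where "X = stiefel_param P W"
  have invD: "invertible D" and invM: "invertible (mat 1 - T)"
    using assms by (auto simp: stiefel_param_dom_def D_def T_def)
  have PY: "transpose P ** Y = 0"
    by (simp add: Y_def transpose_mult_stiefel_normal)
  have Yw: "Y *v w = (W - P ** T) *v ((mat 1 - T) *v w)" for w
    by (simp add: Y_def T_def stiefel_normal_def matrix_vector_mul_assoc)
  have D: "D *v w = w + T *v w + transpose Y *v (Y *v w)" for w
    unfolding D_def stiefel_denom_def
    by (simp only: matrix_vector_mult_add_rdistrib matrix_vector_mul_lid matrix_vector_mul_assoc T_def Y_def)
  have X: "X *v u = 2 *\<^sub>R ((P + Y) *v (matrix_inv D *v u)) - P *v u" for u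
    by (simp add: X_def stiefel_param_def D_def Y_def algebra_simps matrix_vector_mul_assoc
       scaleR_matrix_vector_assoc)
  show ?thesis
  proof
    assume "P *v u0 \<in> range ((*v) (stiefel_param P W))"
    then obtain u where u: "X *v u = P *v u0" by (auto simp: X_def)
    define r where "r = matrix_inv D *v u"
    have r: "D *v r = u"
      by (simp add: r_def matrix_vector_mul_assoc matrix_inv_right[OF invD])
    have 1: "2 *\<^sub>R ((P + Y) *v r) = P *v (u + u0)"
      using u unfolding X by (simp add: r_def algebra_simps)
    \<comment> \<open>Applying \<open>P^T\<close> kills the \<open>Y\<close> part, which identifies
      \<open>2 r\<close> with \<open>w = u + u0\<close>; putting this back into the equation leaves
      \<open>Y w = 0\<close>.\<close>
    have "transpose P *v (P *v (u + u0)) = 2 *\<^sub>R r"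
      unfolding 1[symmetric] by (simp add: matrix_vector_mult_scaleR matrix_vector_mul_assoc matrix_distribs P PY
        del: transpose_matrix_vector)
    then have w: "2 *\<^sub>R r = u + u0"
      by (simp add: matrix_vector_mul_assoc P del: transpose_matrix_vector)
    have "(P + Y) *v (u + u0) = P *v (u + u0)"
      using 1 by (simp only: matrix_vector_mult_scaleR flip: w)
    then have Y0: "Y *v (u + u0) = 0"
      by (simp only: matrix_vector_mult_add_rdistrib add_cancel_left_right)
    have "D *v (u + u0) = 2 *\<^sub>R u"
      by (simp add: matrix_vector_mult_scaleR r flip: w)
    then have "T *v (u + u0) = 2 *\<^sub>R u - (u + u0)"
      unfolding D Y0 by (simp add: eq_diff_eq add.commute)
    then have "(mat 1 - T) *v (u + u0) = 2 *\<^sub>R u0"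
      by (simp add: matrix_vector_mult_diff_rdistrib) (simp add: scaleR_2)
    with Yw[of "u + u0"] Y0 show "(W - P ** (transpose P ** W)) *v u0 = 0"
      by (simp add: matrix_vector_mult_scaleR T_def)
  next
    assume 0: "(W - P ** (transpose P ** W)) *v u0 = 0"
    \<comment> \<open>Conversely, \<open>w\<close> is chosen to solve
      \<open>(1 - T) w = 2 u0\<close>; the preimage of \<open>P *v u0\<close> under \<open>X\<close>
      will be \<open>w - u0\<close>.\<close>
    define w where "w = 2 *\<^sub>R (matrix_inv (mat 1 - T) *v u0)"
    have Mw: "(mat 1 - T) *v w = 2 *\<^sub>R u0"
      by (simp add: w_def matrix_vector_mult_scaleR matrix_vector_mul_assoc matrix_inv_right[OF invM])
    then have Y0: "Y *v w = 0"
      using 0 by (simp add: Yw matrix_vector_mult_scaleR T_def)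
    have "D *v w = 2 *\<^sub>R (w - u0)"
      using Mw by (simp add: D Y0 matrix_vector_mult_diff_rdistrib algebra_simps scaleR_2)
    then have "2 *\<^sub>R (matrix_inv D *v (w - u0)) = matrix_inv D *v (D *v w)"
      by (simp add: matrix_vector_mult_scaleR)
    also have "\<dots> = w"
      by (simp add: matrix_vector_mul_assoc matrix_inv_left[OF invD])
    finally have "2 *\<^sub>R ((P + Y) *v (matrix_inv D *v (w - u0))) = (P + Y) *v w"
      by (simp flip: matrix_vector_mult_scaleR)
    then have "X *v (w - u0) = P *v u0"
      by (simp add: X Y0 algebra_simps)
    then show "P *v u0 \<in> range ((*v) (stiefel_param P W))"
      unfolding X_def by (metis rangeI)
  qed
qed

end

section \<open>Dimensions of the model spaces\<close>

text \<open>Rank-nullity: on the orthogonal complement \<open>?S\<close> of the kernel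
  \<open>f\<close> is injective and has the same range, because the kernel component of any
  \<open>x\<close> contributes nothing.\<close>

lemma dim_kernel_add_dim_range:
  fixes f :: "'a::euclidean_space \<Rightarrow> 'b::euclidean_space"
  assumes "linear f"
  shows "dim {x. f x = 0} + dim (range f) = DIM('a)"
proof -
  let ?K = "{x. f x = 0}"
  let ?S = "{y \<in> UNIV. \<forall>x\<in>?K. orthogonal x y}"
  have K: "subspace ?K" using assms by (rule linear_subspace_kernel)
  have S: "subspace ?S"
    by (auto simp: subspace_def orthogonal_clauses)
  have "dim ?S + dim ?K = dim (UNIV :: 'a set)"
    by (rule dim_subspace_orthogonal_to_vectors[OF K]) auto
  moreover have "range f = f ` ?S"
  proof
    show "range f \<subseteq> f ` ?S"
    proof
      fix y assume "y \<in> range f"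
      then obtain x where x: "y = f x" by blast
      obtain a b where "a \<in> span ?K" "\<And>w. w \<in> span ?K \<Longrightarrow> orthogonal b w" "x = a + b"
        using orthogonal_subspace_decomp_exists[of ?K x] by blast
      moreover from this K have "f a = 0" by (simp add: span_eq_iff[THEN iffD2])
      ultimately have "y = f b" "b \<in> ?S"
        using linear_add[OF assms] by (auto simp: x orthogonal_commute span_base)
      then show "y \<in> f ` ?S" by blast
    qed
  qed auto
  moreover have "inj_on f ?S"
  proof (rule inj_onI)
    fix x y assume "x \<in> ?S" "y \<in> ?S" "f x = f y"
    then have "x - y \<in> ?S" "x - y \<in> ?K"
      using subspace_diff[OF S] linear_diff[OF assms] by auto
    then have "orthogonal (x - y) (x - y)" by blast
    then show "x = y" by (simp add: orthogonal_self)
  qed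
  then have "dim (f ` ?S) = dim ?S"
    using S by (intro dim_image_eq assms) (simp add: span_eq_iff[THEN iffD2])
  ultimately show ?thesis by simp
qed

text \<open>A basis is indexed by the unordered pairs \<open>{i, j}\<close>: singletons give the
  diagonal units, two-element sets the symmetrized off-diagonal ones. Different members have
  disjoint supports and are therefore orthogonal.\<close>

lemma dim_symmetric_matrices:
  "dim {A :: real^'q^'q. transpose A = A} = CARD('q) + (CARD('q) choose 2)"
proof -
  let ?I = "{s :: 'q set. card s = 1} \<union> {s. card s = 2}"
  define E :: "'q set \<Rightarrow> real^'q^'q" where "E = (\<lambda>s. \<chi> i j. if {i, j} = s then 1 else 0)"
  have I: "s \<in> ?I \<longleftrightarrow> (\<exists>i j. s = {i, j})" for s :: "'q set"
  proof
    assume "s \<in> ?I"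
    then consider "card s = 1" | "card s = 2" by blast
    then show "\<exists>i j. s = {i, j}"
    proof cases
      case 1
      then obtain i where "s = {i}" by (rule card_1_singletonE)
      then have "s = {i, i}" by simp
      then show ?thesis by blast
    next
      case 2
      then show ?thesis by (auto simp: card_2_iff)
    qed
  next
    assume "\<exists>i j. s = {i, j}"
    then obtain i j where "s = {i, j}" by blast
    then show "s \<in> ?I" by (cases "i = j") auto
  qed
  have nz: "E {i, j} $ i $ j = 1" for i j by (simp add: E_def)
  have E_eq: "s = t" if "s \<in> ?I" "E s = E t" for s t
  proof -
    obtain i j where s: "s = {i, j}" using \<open>s \<in> ?I\<close> I by blast
    have "E t $ i $ j = 1" using nz[of i j] that(2) by (simp add: s)
    then show ?thesis by (simp add: E_def s split: if_splits)
  qed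
  have "pairwise orthogonal (E ` ?I)"
  proof (rule pairwiseI)
    fix A B assume "A \<in> E ` ?I" "B \<in> E ` ?I" "A \<noteq> B"
    then obtain s t where "A = E s" "B = E t" "s \<noteq> t" by blast
    then have "A $ i $ j * B $ i $ j = 0" for i j
      by (auto simp: E_def)
    then show "orthogonal A B"
      by (simp only: orthogonal_def inner_vec_def inner_real_def sum.neutral_const)
  qed
  moreover have "0 \<notin> E ` ?I"
  proof
    assume "0 \<in> E ` ?I"
    then obtain s where "0 = E s" "s \<in> ?I" by (rule imageE)
    moreover from this obtain i j where "s = {i, j}" using I by blast
    ultimately show False using nz[of i j] by (metis zero_index zero_neq_one)
  qed
  ultimately have indep: "independent (E ` ?I)"
    by (rule pairwise_orthogonal_independent)
  have span: "span (E ` ?I) = {A. transpose A = A}"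
  proof (rule span_unique)
    show "E ` ?I \<subseteq> {A. transpose A = A}"
      by (auto simp: E_def transpose_def vec_eq_iff insert_commute)
    show "subspace {A :: real^'q^'q. transpose A = A}"
      by (auto simp: subspace_def transpose_def vec_eq_iff)
    fix V :: "(real^'q^'q) set" assume V: "E ` ?I \<subseteq> V" "subspace V"
    show "{A. transpose A = A} \<subseteq> V"
    proof
      fix A :: "real^'q^'q" assume "A \<in> {A. transpose A = A}"
      then have sym: "A $ i $ j = A $ j $ i" for i j
        by (auto simp: transpose_def vec_eq_iff)
      \<comment> \<open>The coefficient of \<open>E {i, j}\<close> is the common value of the
        entries at \<open>(i, j)\<close> and \<open>(j, i)\<close>; symmetry makes the choice well
        defined.\<close>
      define a where "a = (\<lambda>s. SOME c. \<exists>i j. s = {i, j} \<and> c = A $ i $ j)"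
      have a: "a {i, j} = A $ i $ j" for i j
        unfolding a_def by (rule some_equality) (auto simp: doubleton_eq_iff sym)
      have "A = (\<Sum>s\<in>?I. a s *\<^sub>R E s)"
      proof -
        have "(\<Sum>s\<in>?I. a s *\<^sub>R E s) $ i $ j = (\<Sum>s\<in>?I. if s = {i, j} then a s else 0)" for i j
          unfolding sum_component by (intro sum.cong) (auto simp: E_def)
        also have "\<dots> i j = A $ i $ j" for i j
          using I[of "{i, j}"] by (subst sum.delta) (auto simp: a)
        finally show ?thesis by (simp add: vec_eq_iff)
      qed
      also have "\<dots> \<in> V"
        using V by (intro subspace_sum subspace_scale) auto
      finally show "A \<in> V" .
    qed
  qed
  have "dim {A :: real^'q^'q. transpose A = A} = card (E ` ?I)"
    by (simp only: dim_span dim_eq_card_independent[OF indep] flip: span)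
  also have "\<dots> = card ?I"
    by (intro card_image inj_onI E_eq)
  also have "\<dots> = card {s :: 'q set. card s = 1} + card {s :: 'q set. card s = 2}"
    by (intro card_Un_disjoint) auto
  also have "\<dots> = CARD('q) + (CARD('q) choose 2)"
    using n_subsets[of "UNIV :: 'q set" 1] n_subsets[of "UNIV :: 'q set" 2] by simp
  finally show ?thesis .
qed

section \<open>The linear slices as kernels, and their dimensions\<close>

lemma subspace_symmetric_matrices: "subspace {A :: real^'q^'q. transpose A = A}"
  by (auto simp: subspace_def transpose_def vec_eq_iff)

text \<open>The kernel of the differential of \<open>X^T X\<close> at \<open>P\<close>, that is, the
  tangent space of the Stiefel manifold for \<open>P\<close> on it.\<close>

definition stiefel_tangent :: "real^'q^'n \<Rightarrow> (real^'q^'n) set" where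
  "stiefel_tangent P = {W. transpose P ** W + transpose W ** P = 0}"

text \<open>For \<open>P\<close> with orthonormal columns the added equation says that
  \<open>W *v u\<close> lies in the column space of \<open>P\<close>. This is what differentiating
  \<open>v = X(t) u(t)\<close> gives at \<open>X = P\<close>.\<close>

definition stiefel_through_tangent :: "real^'q^'n \<Rightarrow> real^'q \<Rightarrow> (real^'q^'n) set" where
  "stiefel_through_tangent P u = {W \<in> stiefel_tangent P. (W - P ** (transpose P ** W)) *v u = 0}"

lemma stiefel_eq_sym: "transpose (transpose P ** W + transpose W ** P) = transpose P ** W + transpose W ** (P :: real^'q^'n)"
  by (simp add: matrix_distribs add.commute)

lemma linear_stiefel_eq: "linear (\<lambda>W. transpose P ** W + transpose W ** (P :: real^'q^'n))"
  by (rule linearI) (simp_all add: matrix_distribs scaleR_add_right)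

lemma linear_stiefel_through_eq:
  "linear (\<lambda>W. (transpose P ** W + transpose W ** P, (W - P ** (transpose P ** W)) *v u))" for P :: "real^'q^'n"
  by (rule linearI) (simp_all add: matrix_distribs algebra_simps scaleR_matrix_vector_assoc)

lemma subspace_stiefel_tangent: "subspace (stiefel_tangent P)"
  unfolding stiefel_tangent_def by (rule linear_subspace_kernel[OF linear_stiefel_eq])

lemma subspace_stiefel_through_tangent: "subspace (stiefel_through_tangent P u)"
  using linear_subspace_kernel[OF linear_stiefel_through_eq[of P u]]
  by (simp add: stiefel_through_tangent_def stiefel_tangent_def zero_prod_def)

text \<open>Rank-nullity for a map onto the symmetric matrices: \<open>A\<close> is the image of
  \<open>P (A/2)\<close>. The additive form avoids truncated subtraction.\<close>

lemma dim_stiefel_tangent: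
  fixes P :: "real^'q^'n"
  assumes P: "transpose P ** P = mat 1"
  shows "dim (stiefel_tangent P) + (CARD('q) + (CARD('q) choose 2)) = CARD('n) * CARD('q)"
proof -
  have "range (\<lambda>W. transpose P ** W + transpose W ** P) = {A. transpose A = A}"
  proof (intro equalityI subsetI)
    fix A :: "real^'q^'q" assume "A \<in> {A. transpose A = A}"
    then have "A = transpose P ** (P ** ((1/2) *\<^sub>R A)) + transpose (P ** ((1/2) *\<^sub>R A)) ** P"
      by (simp add: matrix_distribs matrix_mul_assoc P flip: scaleR_add_left)
        (simp add: matrix_distribs P flip: matrix_mul_assoc scaleR_add_left)
    then show "A \<in> range (\<lambda>W. transpose P ** W + transpose W ** P)" by blast
  qed (auto simp: stiefel_eq_sym)
  then show ?thesis
    using dim_kernel_add_dim_range[OF linear_stiefel_eq[of P]] dim_symmetric_matrices[where 'q='q]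
    by (simp add: stiefel_tangent_def)
qed

text \<open>The two conditions are independent: the part \<open>P (A/2)\<close> of \<open>W\<close>
  prescribes the symmetric matrix, the part orthogonal to \<open>P\<close> prescribes the vector in
  the kernel of \<open>P^T\<close>, which has dimension \<open>n - q\<close>. The joint map is thus
  onto the product.\<close>

lemma dim_stiefel_through_tangent:
  fixes P :: "real^'q^'n"
  assumes P: "transpose P ** P = mat 1" and "u \<noteq> 0"
  shows "dim (stiefel_through_tangent P u) + (CARD('q) + (CARD('q) choose 2)) + CARD('n) =
    CARD('n) * CARD('q) + CARD('q)"
proof -
  let ?S = "{A :: real^'q^'q. transpose A = A}" and ?N = "{y. transpose P *v y = 0}"
  let ?f = "\<lambda>W. (transpose P ** W + transpose W ** P, (W - P ** (transpose P ** W)) *v u)"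
  have "range ?f = ?S \<times> ?N"
  proof (intro equalityI subsetI)
    fix z assume "z \<in> range ?f"
    then obtain W where "z = ?f W" by blast
    moreover have "transpose P ** (W - P ** (transpose P ** W)) = 0"
      by (simp add: matrix_distribs matrix_mul_assoc P)
    then have "transpose P *v ((W - P ** (transpose P ** W)) *v u) = 0"
      by (simp add: matrix_vector_mul_assoc del: transpose_matrix_vector)
    ultimately show "z \<in> ?S \<times> ?N"
      using stiefel_eq_sym[of P W] by (simp del: transpose_matrix_vector)
  next
    fix z assume "z \<in> ?S \<times> ?N"
    then obtain A y where z: "z = (A, y)" and A: "transpose A = A" and y: "transpose P *v y = 0"
      by blast
    define c where "c = u \<bullet> u"
    \<comment> \<open>The rank-one matrix \<open>y u^T / (u \<bullet> u)\<close> sends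
      \<open>u\<close> to \<open>y\<close> and keeps its columns in the kernel of
      \<open>P^T\<close>.\<close>
    define Q :: "real^'q^'n" where "Q = (\<chi> i j. y $ i * (u $ j / c))"
    have "(transpose P ** Q) $ i $ j = (transpose P *v y) $ i * (u $ j / c)" for i j
      by (simp add: Q_def matrix_matrix_mult_def matrix_vector_mult_def sum_distrib_right sum_divide_distrib mult.assoc
          del: transpose_matrix_vector)
    then have PQ: "transpose P ** Q = 0"
      unfolding y by (simp add: vec_eq_iff)
    have "transpose Q ** P = transpose (transpose P ** Q)"
      by (simp add: matrix_transpose_mul)
    then have QP: "transpose Q ** P = 0"
      by (simp add: PQ matrix_distribs)
    have "(Q *v u) $ i = y $ i * ((\<Sum>j\<in>UNIV. u $ j * u $ j) / c)" for i
      by (simp add: Q_def matrix_vector_mult_def sum_distrib_left sum_divide_distrib mult.assoc)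
    moreover have "(\<Sum>j\<in>UNIV. u $ j * u $ j) = c" "c \<noteq> 0"
      using \<open>u \<noteq> 0\<close> by (simp_all add: c_def) (simp add: inner_vec_def)
    ultimately have Qu: "Q *v u = y"
      by (simp add: vec_eq_iff)
    define W where "W = P ** ((1/2) *\<^sub>R A) + Q"
    have PW: "transpose P ** W = (1/2) *\<^sub>R A"
      by (simp add: W_def matrix_distribs matrix_mul_assoc P PQ)
    have "transpose W ** P = transpose (transpose P ** W)"
      by (simp add: matrix_transpose_mul)
    then have WP: "transpose W ** P = (1/2) *\<^sub>R A"
      by (simp add: PW matrix_distribs A)
    have "?f W = z"
      unfolding WP PW z by (simp add: W_def Qu flip: scaleR_add_left)
    then show "z \<in> range ?f" by blast
  qed
  moreover have "subspace ?N"
    by (rule linear_subspace_kernel[OF matrix_vector_mul_linear])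
  then have "dim (?S \<times> ?N) = dim ?S + dim ?N"
    by (rule dim_Times[OF subspace_symmetric_matrices])
  moreover have "dim ?N + CARD('q) = CARD('n)"
  proof -
    \<comment> \<open>Having \<open>P\<close> as a right inverse, \<open>P^T\<close> is onto, so its
      kernel has dimension \<open>n - q\<close>.\<close>
    have "x = transpose P *v (P *v x)" for x
      by (simp add: matrix_vector_mul_assoc P del: transpose_matrix_vector)
    then have "range ((*v) (transpose P)) = UNIV"
      by (metis surjI)
    then show ?thesis
      using dim_kernel_add_dim_range[OF matrix_vector_mul_linear[of "transpose P"]] by (simp del: transpose_matrix_vector)
  qed
  moreover have "{W. ?f W = 0} = stiefel_through_tangent P u"
    by (auto simp: stiefel_through_tangent_def stiefel_tangent_def zero_prod_def)
  ultimately show ?thesis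
    using dim_kernel_add_dim_range[OF linear_stiefel_through_eq[of P u]] dim_symmetric_matrices[where 'q='q]
    by simp
qed

lemma span_columns: "span (columns X) = range ((*v) X)" for X :: "real^'q^'n"
proof
  show "range ((*v) X) \<subseteq> span (columns X)"
    using matrix_vector_mult_in_columnspace by blast
  have "columns X \<subseteq> range ((*v) X)"
    by (auto simp: columns_def simp flip: matrix_vector_mult_basis)
  then show "span (columns X) \<subseteq> range ((*v) X)"
    by (rule span_minimal) (simp add: linear_subspace_image)
qed

lemma stiefel_through_eq:
  "stiefel_through v = {X \<in> stiefel. v \<in> range ((*v) X)}"
  by (simp add: stiefel_through_def stiefel_def span_columns)

section \<open>The submanifold theorem\<close>

text \<open>For orthonormal columns \<open>X X^T\<close> is the orthogonal projector onto the column
  space, so \<open>v \<in> span X\<close> becomes the closed condition \<open>X X^T v = v\<close>.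
  Boundedness holds since the squared norm of \<open>X\<close> is the trace of \<open>X^T X\<close>,
  namely \<open>q\<close>.\<close>

lemma compact_stiefel_through: "compact (stiefel_through v :: (real^'q^'n) set)"
proof -
  have "v \<in> range ((*v) X) \<longleftrightarrow> (X ** transpose X) *v v = v" if "transpose X ** X = mat 1" for X :: "real^'q^'n"
  proof
    assume "v \<in> range ((*v) X)"
    then obtain u where u: "v = X *v u" by blast
    have "(X ** transpose X) *v (X *v u) = (X ** (transpose X ** X)) *v u"
      by (simp only: matrix_vector_mul_assoc matrix_mul_assoc)
    then show "(X ** transpose X) *v v = v"
      unfolding that matrix_mul_rid u .
  next
    assume "(X ** transpose X) *v v = v"
    then have "v = X *v (transpose X *v v)"
      by (simp only: matrix_vector_mul_assoc)
    then show "v \<in> range ((*v) X)" by (rule range_eqI)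
  qed
  then have eq: "stiefel_through v = {X :: real^'q^'n. transpose X ** X = mat 1} \<inter> {X. (X ** transpose X) *v v = v}"
    by (auto simp: stiefel_through_eq stiefel_def)
  have T: "continuous_on UNIV (transpose :: real^'q^'n \<Rightarrow> _)"
    by (rule linear_continuous_on[OF bounded_linear_transpose])
  have "linear (\<lambda>A :: real^'n^'n. A *v v)"
    by (rule linearI) (simp_all add: algebra_simps scaleR_matrix_vector_assoc)
  then have "bounded_linear (\<lambda>A :: real^'n^'n. A *v v)"
    by (simp add: linear_conv_bounded_linear)
  then have "continuous_on UNIV (\<lambda>X :: real^'q^'n. (X ** transpose X) *v v)"
    by (rule bounded_linear.continuous_on) (intro bounded_bilinear.continuous_on[OF bounded_bilinear_matrix_mult] T continuous_on_id)
  moreover have "continuous_on UNIV (\<lambda>X :: real^'q^'n. transpose X ** X)"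
    by (intro bounded_bilinear.continuous_on[OF bounded_bilinear_matrix_mult] T continuous_on_id)
  ultimately have "closed (stiefel_through v :: (real^'q^'n) set)"
    unfolding eq by (intro closed_Int closed_Collect_eq continuous_on_const)
  moreover have "norm X = sqrt (real CARD('q))" if "X \<in> stiefel_through v" for X :: "real^'q^'n"
  proof -
    have "X \<bullet> X = (\<Sum>j\<in>UNIV. (transpose X ** X) $ j $ j)"
      unfolding inner_vec_def matrix_matrix_mult_def transpose_def
      by (simp add: inner_real_def sum.swap[of _ UNIV "UNIV :: 'q set"])
    also have "\<dots> = real CARD('q)"
      using that by (simp add: stiefel_through_def mat_def)
    finally show ?thesis by (simp add: norm_eq_sqrt_inner)
  qed
  then have "bounded (stiefel_through v :: (real^'q^'n) set)"
    by (intro boundedI) auto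
  ultimately show ?thesis by (simp add: compact_eq_bounded_closed)
qed

section \<open>Openness of the coordinate domains and smoothness of the coordinate maps\<close>

lemma open_stiefel_param_dom: "open (stiefel_param_dom P)"
proof -
  have "open ({W \<in> UNIV. invertible (stiefel_denom P W)} \<inter> {W \<in> UNIV. invertible (mat 1 - transpose P ** W)})"
    unfolding stiefel_denom_def stiefel_normal_def
    by (intro open_Int open_invertible Ck_on_intros open_UNIV)
  then show ?thesis by (simp add: stiefel_param_dom_def Int_def)
qed

lemma Ck_on_stiefel_param: "Ck_on r (stiefel_param_dom P) (stiefel_param P)"
proof -
  have "Ck_on r (stiefel_param_dom P) (\<lambda>W. stiefel_param P W)"
    unfolding stiefel_param_def stiefel_denom_def stiefel_normal_def
    by (intro Ck_on_intros open_stiefel_param_dom)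
      (simp add: stiefel_param_dom_def stiefel_denom_def stiefel_normal_def)
  then show ?thesis .
qed

lemma open_stiefel_chart_dom: "open (stiefel_chart_dom P)"
proof -
  let ?U = "{X \<in> UNIV. invertible (mat 1 + transpose P ** X)}"
  have U: "open ?U"
    by (intro open_invertible Ck_on_intros open_UNIV)
  \<comment> \<open>The second condition involves the inverse of the first matrix, so its openness
    is proved relative to \<open>?U\<close>.\<close>
  have "open {X \<in> ?U. invertible (mat 1 - chart_tangent P X)}"
    unfolding chart_tangent_def chart_normal_def
    by (intro open_invertible U Ck_on_intros) auto
  then show ?thesis by (simp add: stiefel_chart_dom_def)
qed

lemma Ck_on_stiefel_chart: "Ck_on r (stiefel_chart_dom P) (stiefel_chart P)"
proof -
  have "Ck_on r (stiefel_chart_dom P) (\<lambda>X. stiefel_chart P X)"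
    unfolding stiefel_chart_def chart_tangent_def chart_normal_def
    by (intro Ck_on_intros open_stiefel_chart_dom)
      (simp_all add: stiefel_chart_dom_def chart_tangent_def chart_normal_def)
  then show ?thesis .
qed

text \<open>Serves all three slice conditions: Stiefel in the ambient space, and the set through
  \<open>v\<close> in each of the two. What remains is to name the linear spaces \<open>L\<close>
  and \<open>K\<close> in coordinates centred at \<open>P\<close>.\<close>

lemma slice_condition_stiefel_chart:
  fixes M N :: "(real^'q^'n) set"
  assumes "M \<subseteq> N" "M \<subseteq> stiefel"
    and LK: "\<And>P. P \<in> M \<Longrightarrow> \<exists>L K. subspace L \<and> subspace K \<and> K \<subseteq> L \<and> dim L = m \<and> dim K = k \<and>
      (\<forall>W\<in>stiefel_param_dom P. (stiefel_param P W \<in> N \<longleftrightarrow> W \<in> L) \<and> (stiefel_param P W \<in> M \<longleftrightarrow> W \<in> K))"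
  shows "slice_condition N m M k"
proof (rule slice_conditionI)
  fix P assume "P \<in> M"
  then have P: "transpose P ** P = mat 1" using assms(2) by (auto simp: stiefel_def)
  obtain L K where "subspace L" "subspace K" "K \<subseteq> L" "dim L = m" "dim K = k"
    "\<forall>W\<in>stiefel_param_dom P. (stiefel_param P W \<in> N \<longleftrightarrow> W \<in> L) \<and> (stiefel_param P W \<in> M \<longleftrightarrow> W \<in> K)"
    using LK[OF \<open>P \<in> M\<close>] by blast
  then show "\<exists>U V (\<Phi> :: real^'q^'n \<Rightarrow> real^'q^'n) \<Psi> L K. P \<in> U \<and> open U \<and> open V \<and>
      (\<forall>r. Ck_on r U \<Phi>) \<and> (\<forall>r. Ck_on r V \<Psi>) \<and>
      (\<forall>x\<in>U. \<Phi> x \<in> V \<and> \<Psi> (\<Phi> x) = x) \<and> (\<forall>y\<in>V. \<Psi> y \<in> U \<and> \<Phi> (\<Psi> y) = y) \<and>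
      subspace L \<and> subspace K \<and> K \<subseteq> L \<and> dim L = m \<and> dim K = k \<and>
      (\<forall>y\<in>V. \<Psi> y \<in> N \<longleftrightarrow> y \<in> L) \<and> (\<forall>y\<in>V. \<Psi> y \<in> M \<longleftrightarrow> y \<in> K)"
    using base_in_stiefel_chart_dom[OF P] open_stiefel_chart_dom[of P] open_stiefel_param_dom[of P]
      Ck_on_stiefel_chart[of _ P] Ck_on_stiefel_param[of _ P]
      stiefel_chart_inverse[OF P] stiefel_param_inverse[OF P]
    by (intro exI[of _ "stiefel_chart_dom P"] exI[of _ "stiefel_param_dom P"] exI[of _ "stiefel_chart P"]
        exI[of _ "stiefel_param P"] exI[of _ L] exI[of _ K]) simp
qed fact

theorem theorem3p1:
  fixes v :: "real^'n"
  assumes "CARD('q) \<le> CARD('n)"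
    and "\<forall>i. 0 < v $ i"
  shows "\<exists>d k. embedded_submanifold (stiefel :: (real^'q^'n) set) d \<and>
      real k = real d - (real CARD('n) - real CARD('q)) \<and>
      real k = real CARD('n) * real CARD('q) - real CARD('q) * (real CARD('q) + 1) / 2
                 - real CARD('n) + real CARD('q) \<and>
      embedded_submanifold_of stiefel (stiefel_through v :: (real^'q^'n) set) k \<and>
      embedded_submanifold (stiefel_through v :: (real^'q^'n) set) k \<and>
      compact (stiefel_through v :: (real^'q^'n) set)"
proof -
  let ?St = "stiefel :: (real^'q^'n) set" and ?F = "stiefel_through v :: (real^'q^'n) set"
  \<comment> \<open>The dimension of the symmetric matrices, equal to \<open>q(q+1)/2\<close>; the
    subtractions in \<open>d\<close> and \<open>k\<close> are shown below not to truncate.\<close>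
  define s where "s = CARD('q) + (CARD('q) choose 2)"
  define d where "d = CARD('n) * CARD('q) - s"
  define k where "k = d - (CARD('n) - CARD('q))"
  \<comment> \<open>This forces \<open>u \<noteq> 0\<close> whenever \<open>v = P *v u\<close>, as
    the dimension count requires.\<close>
  have "v \<noteq> 0" using assms(2) by (metis less_irrefl zero_index)
  have F_St: "?F \<subseteq> ?St" by (auto simp: stiefel_through_eq)
  have St_iff: "stiefel_param P W \<in> ?St \<longleftrightarrow> W \<in> stiefel_tangent P"
    if "P \<in> ?St" "W \<in> stiefel_param_dom P" for P W
    using that stiefel_param_in_stiefel_iff[of P W] by (simp add: stiefel_tangent_def) (simp add: stiefel_def)
  have dim_St: "dim (stiefel_tangent P) = d" if "P \<in> ?St" for P
    using dim_stiefel_tangent[of P] that by (simp add: d_def s_def stiefel_def)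
  have ex_K: "\<exists>K. subspace K \<and> K \<subseteq> stiefel_tangent P \<and> dim K = k \<and>
      (\<forall>W\<in>stiefel_param_dom P. stiefel_param P W \<in> ?F \<longleftrightarrow> W \<in> K)" if "P \<in> ?F" for P
  proof -
    have P: "P \<in> ?St" "transpose P ** P = mat 1"
      using that F_St by (auto simp: stiefel_def)
    have "v \<in> range ((*v) P)"
      using that by (simp add: stiefel_through_eq)
    then obtain u where u: "v = P *v u" by blast
    with \<open>v \<noteq> 0\<close> have "u \<noteq> 0" by auto
    have "stiefel_param P W \<in> ?F \<longleftrightarrow> W \<in> stiefel_through_tangent P u" if "W \<in> stiefel_param_dom P" for W
      using St_iff[OF P(1) that] range_stiefel_param_iff[OF P(2) that, of u]
      by (simp add: stiefel_through_eq stiefel_through_tangent_def u)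
    moreover have "dim (stiefel_through_tangent P u) = k"
      using dim_stiefel_through_tangent[OF P(2) \<open>u \<noteq> 0\<close>] assms(1) by (simp add: k_def d_def s_def)
    ultimately show ?thesis
      using subspace_stiefel_through_tangent
      by (intro exI[of _ "stiefel_through_tangent P u"]) (auto simp: stiefel_through_tangent_def)
  qed
  have St: "embedded_submanifold ?St d"
    unfolding embedded_submanifold_def
  proof (rule slice_condition_stiefel_chart)
    fix P assume "P \<in> ?St"
    from St_iff[OF this] dim_St[OF this] subspace_stiefel_tangent[of P]
    show "\<exists>L K. subspace L \<and> subspace K \<and> K \<subseteq> L \<and> dim L = DIM(real^'q^'n) \<and> dim K = d \<and>
      (\<forall>W\<in>stiefel_param_dom P. (stiefel_param P W \<in> UNIV \<longleftrightarrow> W \<in> L) \<and> (stiefel_param P W \<in> ?St \<longleftrightarrow> W \<in> K))"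
      \<comment> \<open>With the whole space as \<open>N\<close> the larger slice is the whole
        coordinate space.\<close>
      by (intro exI[of _ UNIV] exI[of _ "stiefel_tangent P"]) auto
  qed auto
  have "slice_condition ?St d ?F k"
  proof (rule slice_condition_stiefel_chart[OF F_St F_St])
    fix P assume "P \<in> ?F"
    with F_St have "P \<in> ?St" by blast
    obtain K where "subspace K" "K \<subseteq> stiefel_tangent P" "dim K = k"
      "\<forall>W\<in>stiefel_param_dom P. stiefel_param P W \<in> ?F \<longleftrightarrow> W \<in> K"
      using ex_K[OF \<open>P \<in> ?F\<close>] by blast
    with St_iff[OF \<open>P \<in> ?St\<close>] dim_St[OF \<open>P \<in> ?St\<close>] subspace_stiefel_tangent[of P]
    show "\<exists>L K. subspace L \<and> subspace K \<and> K \<subseteq> L \<and> dim L = d \<and> dim K = k \<and>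
      (\<forall>W\<in>stiefel_param_dom P. (stiefel_param P W \<in> ?St \<longleftrightarrow> W \<in> L) \<and> (stiefel_param P W \<in> ?F \<longleftrightarrow> W \<in> K))"
      by (intro exI[of _ "stiefel_tangent P"] exI[of _ K]) simp
  qed
  with St F_St have "embedded_submanifold_of ?St ?F k"
    by (auto simp: embedded_submanifold_of_def)
  moreover have "embedded_submanifold ?F k"
    unfolding embedded_submanifold_def
  proof (rule slice_condition_stiefel_chart[OF _ F_St])
    fix P assume "P \<in> ?F"
    obtain K where "subspace K" "dim K = k" "\<forall>W\<in>stiefel_param_dom P. stiefel_param P W \<in> ?F \<longleftrightarrow> W \<in> K"
      using ex_K[OF \<open>P \<in> ?F\<close>] by blast
    then show "\<exists>L K. subspace L \<and> subspace K \<and> K \<subseteq> L \<and> dim L = DIM(real^'q^'n) \<and> dim K = k \<and>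
      (\<forall>W\<in>stiefel_param_dom P. (stiefel_param P W \<in> UNIV \<longleftrightarrow> W \<in> L) \<and> (stiefel_param P W \<in> ?F \<longleftrightarrow> W \<in> K))"
      by (intro exI[of _ UNIV] exI[of _ K]) simp
  qed simp
  moreover have "2 * real s = real CARD('q) * (real CARD('q) + 1)"
    \<comment> \<open>This bound makes both natural-number subtractions exact. It adds
      \<open>s \<le> q * q\<close>, from \<open>q + 1 \<le> 2 q\<close>, to
      \<open>n - q \<le> (n - q) * q\<close>.\<close>
    and "s + (CARD('n) - CARD('q)) \<le> CARD('n) * CARD('q)"
  proof -
    have "2 * (CARD('q) choose 2) = CARD('q) * (CARD('q) - 1)"
      by (simp add: choose_two)
    then have 2: "2 * s = CARD('q) * (CARD('q) + 1)"
      by (cases "CARD('q)") (simp_all add: s_def)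
    then show "2 * real s = real CARD('q) * (real CARD('q) + 1)"
      by (metis of_nat_1 of_nat_add of_nat_mult of_nat_numeral)
    obtain m where m: "CARD('n) = CARD('q) + m" using assms(1) le_Suc_ex by blast
    have q: "1 \<le> CARD('q)" by simp
    from q have "CARD('q) * (CARD('q) + 1) \<le> 2 * (CARD('q) * CARD('q))" by simp
    with 2 have "s \<le> CARD('q) * CARD('q)" by linarith
    moreover from q have "m \<le> m * CARD('q)" by simp
    ultimately have "s + m \<le> CARD('q) * CARD('q) + m * CARD('q)" by (rule add_mono)
    then show "s + (CARD('n) - CARD('q)) \<le> CARD('n) * CARD('q)"
      by (simp add: m distrib_right)
  qed
  then have "real d = real CARD('n) * real CARD('q) - real CARD('q) * (real CARD('q) + 1) / 2"
    "real k = real d - (real CARD('n) - real CARD('q))"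
    using assms(1) by (simp_all add: d_def k_def of_nat_diff)
  ultimately show ?thesis
    using St compact_stiefel_through[of v] by (intro exI[of _ d] exI[of _ k]) auto
qed

end
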